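(* Let $\mathbb{O}$ be the octahedron graph, i.e., the graph formed by the $6$ vertices and $12$ edges of a regular octahedron (isomorphic to the complete tripartite graph $K_{2,2,2}$). Then $k(\mathbb{O})=2$.
   Context: All graphs are simple and undirected. The competition graph $C(D)$ of a digraph $D$ is the graph with vertex set $V(D)$ in which two distinct vertices $x,y$ are adjacent if and only if there is a vertex $v$ with $(x,v)$ and $(y,v)$ both arcs of $D$. The competition number $k(G)$ of a graph $G$ is the minimum integer $k\ge 0$ such that $G$ together with $k$ new isolated vertices is the competition graph of some acyclic digraph. *)

theory Defs
  imports
    "HOL-Analysis.Polytope"
    "Graph_Theory.Pair_Digraph"
    "Graph_Theory.Digraph_Isomorphism"
begin

text \<open>
  A simple undirected graph is represented, as in \<^theory>\<open>Graph_Theory.Pair_Digraph\<close>, by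
  a finite, symmetric and loop-free arc relation (\<^locale>\<open>pair_graph\<close>).
\<close>

definition competition_graph :: "'a pair_pre_digraph \<Rightarrow> 'a pair_pre_digraph" where
  "competition_graph D =
    \<lparr> pverts = pverts D,
      parcs = {(x, y). x \<in> pverts D \<and> y \<in> pverts D \<and> x \<noteq> y \<and>
        (\<exists>v \<in> pverts D. (x, v) \<in> parcs D \<and> (y, v) \<in> parcs D)} \<rparr>"

definition add_isolated :: "'a pair_pre_digraph \<Rightarrow> nat \<Rightarrow> ('a + nat) pair_pre_digraph" where
  "add_isolated G k =
    \<lparr> pverts = Inl ` pverts G \<union> Inr ` {..<k},
      parcs = map_prod Inl Inl ` parcs G \<rparr>"

text \<open>
  Such a \<^term>\<open>k :: nat\<close> exists for every finite simple graph: one new vertex per edge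
  suffices.
\<close>

definition competition_number :: "'a pair_pre_digraph \<Rightarrow> nat" where
  "competition_number G =
    (LEAST k. \<exists>D. pair_digraph D \<and> acyclic (parcs D) \<and> competition_graph D = add_isolated G k)"

definition polytope_graph :: "'a::euclidean_space set \<Rightarrow> 'a pair_pre_digraph" where
  "polytope_graph P =
    \<lparr> pverts = {x. x extreme_point_of P},
      parcs = {(x, y). x extreme_point_of P \<and> y extreme_point_of P \<and>
        closed_segment x y edge_of P} \<rparr>"

definition regular_octahedron :: "(real^3) set" where
  "regular_octahedron = convex hull (\<Union>i. {axis i 1, - axis i 1})"

definition octahedron_graph :: "(real^3) pair_pre_digraph" where
  "octahedron_graph = polytope_graph regular_octahedron"

text \<open>
  The octahedron graph is the complete tripartite graph $K_{2,2,2}$ whose parts are the three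
  pairs of antipodal vertices.
\<close>

lemma face_of_convex_hull_supporting:
  fixes a :: "'a::euclidean_space"
  assumes "finite S" "T \<subseteq> S" "\<And>t. t \<in> T \<Longrightarrow> a \<bullet> t = b" "\<And>s. s \<in> S - T \<Longrightarrow> a \<bullet> s < b"
  shows "convex hull T face_of convex hull S"
proof (rule face_of_convex_hulls[OF assms(1,2)])
  have "affine hull T \<subseteq> {x. a \<bullet> x = b}"
    by (rule hull_minimal) (use assms(3) in \<open>auto simp: affine_hyperplane\<close>)
  moreover have "convex hull (S - T) \<subseteq> {x. a \<bullet> x < b}"
    by (rule hull_minimal) (use assms(4) in \<open>auto simp: convex_halfspace_lt\<close>)
  ultimately show "affine hull T \<inter> convex hull (S - T) = {}"
    by fastforce
qed

lemma octahedron_graph_pverts: "pverts octahedron_graph = (\<Union>i. {axis i 1, - axis i 1})"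
proof -
  let ?V = "(\<Union>i. {axis i 1, - axis i 1}) :: (real^3) set"
  have "x extreme_point_of convex hull ?V" if "x \<in> ?V" for x
  proof -
    have "convex hull {x} face_of convex hull ?V"
      by (rule face_of_convex_hull_supporting[where a = x and b = 1])
        (use that in \<open>auto simp: inner_axis_axis split: if_splits\<close>)
    then show ?thesis
      by (simp add: face_of_singleton)
  qed
  then show ?thesis
    by (auto simp: octahedron_graph_def polytope_graph_def regular_octahedron_def
        dest: extreme_point_of_convex_hull)
qed

lemma octahedron_graph_parcs:
  "parcs octahedron_graph =
    {(x, y). x \<in> pverts octahedron_graph \<and> y \<in> pverts octahedron_graph \<and> x \<noteq> y \<and> x \<noteq> - y}"
proof -
  let ?V = "(\<Union>i. {axis i 1, - axis i 1}) :: (real^3) set"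
  have edge: "closed_segment x y edge_of convex hull ?V \<longleftrightarrow> x \<noteq> y \<and> x \<noteq> - y"
    if "x \<in> ?V" "y \<in> ?V" for x y
  proof (cases "x = y \<or> x = - y")
    case False
    have "convex hull {x, y} face_of convex hull ?V"
      by (rule face_of_convex_hull_supporting[where a = "x + y" and b = 1])
        (use that False in \<open>auto simp: inner_axis_axis inner_add_left split: if_splits\<close>)
    with False show ?thesis
      by (simp add: edge_of_def segment_convex_hull aff_dim_convex_hull aff_dim_2)
  next
    case True
    have "\<not> closed_segment x y edge_of convex hull ?V"
    proof
      assume edge: "closed_segment x y edge_of convex hull ?V"
      then have "x \<noteq> y"
        by (auto simp: edge_of_def)
      with True have xy: "x = - y"
        by simp
      obtain i where i: "y = axis i 1 \<or> y = - axis i 1"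
        using \<open>y \<in> ?V\<close> by blast
      obtain j :: 3 where "j \<noteq> i"
        by (metis zero_neq_one)
      define z :: "real^3" where "z = axis j 1"
      have yz: "y \<bullet> z = 0" and zz: "z \<bullet> z = 1"
        using i \<open>j \<noteq> i\<close> by (auto simp: z_def inner_axis_axis)
      then have "z \<noteq> - z"
        by (metis inner_minus_left one_neq_neg_one)
      have "z \<in> convex hull ?V" "- z \<in> convex hull ?V"
        by (auto simp: z_def intro: hull_inc)
      moreover have "0 \<in> open_segment z (- z)"
        using \<open>z \<noteq> - z\<close> by (auto simp: in_segment intro: exI[of _ "1 / 2"])
      moreover have "0 \<in> closed_segment x y"
        by (auto simp: xy in_segment intro!: exI[of _ "1 / 2"])
      moreover have "closed_segment x y face_of convex hull ?V"
        using edge by (simp add: edge_of_def)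
      ultimately have "z \<in> closed_segment x y"
        by (blast dest: face_ofD)
      then obtain u where "z = (1 - u) *\<^sub>R x + u *\<^sub>R y"
        by (auto simp: in_segment)
      then have "z \<bullet> z = ((1 - u) *\<^sub>R x + u *\<^sub>R y) \<bullet> z"
        by simp
      also have "\<dots> = 0"
        by (simp add: xy yz inner_diff_left)
      finally show False
        by (simp add: zz)
    qed
    with True show ?thesis by blast
  qed
  have V: "x extreme_point_of convex hull ?V \<longleftrightarrow> x \<in> ?V" for x
    using octahedron_graph_pverts
    by (auto simp: octahedron_graph_def polytope_graph_def regular_octahedron_def)
  show ?thesis
    unfolding octahedron_graph_pverts
    unfolding octahedron_graph_def polytope_graph_def regular_octahedron_def pair_pre_digraph.simps V
    using edge by blast
qed

end

theory Submission
  imports Defs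
begin

text \<open>
  Lower bound: among the vertices of \<open>G\<close>, let \<open>v\<close> be one that has no prey in \<open>G\<close>; it exists
  because the digraph is acyclic. All prey of \<open>v\<close> are new vertices. If there is at most one of
  these, then all neighbours of \<open>v\<close> share it as common prey and hence are pairwise adjacent, whereas
  every vertex of the octahedron has two antipodal neighbours.

  Upper bound: four alternate faces of the octahedron cover every edge exactly once. Two of them,
  say \<open>abc\<close> and \<open>ab'c'\<close>, get the new vertices as common prey; then \<open>a'bc'\<close> can get \<open>a\<close> and \<open>a'b'c\<close>
  can get \<open>b\<close> without creating a cycle.
\<close>

text \<open>Every vertex turns its set of predecessors into a clique. \<open>P\<close> is left free
  so that the lower bound can use \<open>UNIV\<close> and the construction its explicit list of four
  prey.\<close>

lemma (in pair_wf_digraph) parcs_competition_graph: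
  assumes "Range (parcs G) \<subseteq> P"
  shows "parcs (competition_graph G) = (\<Union>p \<in> P. {x. (x, p) \<in> parcs G} \<times> {x. (x, p) \<in> parcs G}) - Id"
  using assms in_arcsD1 in_arcsD2 by (fastforce simp: competition_graph_def)

lemma competition_graph_add_isolated_ge_2:
  fixes G :: "'a pair_pre_digraph"
  assumes D: "pair_digraph D" "acyclic (parcs D)" "competition_graph D = add_isolated G k"
    and ne: "pverts G \<noteq> {}"
    and nonadj: "\<And>v. v \<in> pverts G \<Longrightarrow>
      \<exists>w w'. (v, w) \<in> parcs G \<and> (v, w') \<in> parcs G \<and> w \<noteq> w' \<and> (w, w') \<notin> parcs G"
  shows "2 \<le> k"
proof (rule ccontr)
  assume "\<not> 2 \<le> k"
  interpret pair_digraph D by fact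
  have verts: "pverts D = Inl ` pverts G \<union> Inr ` {..<k}"
    using arg_cong[OF D(3), of pverts] by (simp add: competition_graph_def add_isolated_def)
  have adj: "(x, y) \<in> parcs G \<longleftrightarrow> x \<noteq> y \<and> (\<exists>p. (Inl x, p) \<in> parcs D \<and> (Inl y, p) \<in> parcs D)" for x y
  proof -
    have "(x, y) \<in> parcs G \<longleftrightarrow> (Inl x, Inl y) \<in> parcs (add_isolated G k)"
      by (auto simp: add_isolated_def)
    then show ?thesis
      by (auto simp: parcs_competition_graph[OF subset_UNIV] simp flip: D(3))
  qed
  have "wf ((parcs D)\<inverse>)"
    using pair_finite_arcs D(2) by (rule finite_acyclic_wf_converse)
  moreover obtain u :: "'a + nat" where "u \<in> Inl ` pverts G"
    using ne by blast
  ultimately obtain v where v: "v \<in> pverts G" "\<And>p. (Inl v, p) \<in> parcs D \<Longrightarrow> p \<notin> Inl ` pverts G"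
    by (rule wfE_min) auto
  \<comment> \<open>As \<open>k\<close> is 0 or 1, a new vertex can only be
    \<open>Inr 0\<close>.\<close>
  have prey: "p = Inr 0" if "(Inl v, p) \<in> parcs D" for p
    using v(2)[OF that] in_arcsD2[OF that] verts \<open>\<not> 2 \<le> k\<close> by auto
  obtain w w' where w: "(v, w) \<in> parcs G" "(v, w') \<in> parcs G" "w \<noteq> w'" "(w, w') \<notin> parcs G"
    using nonadj[OF v(1)] by blast
  have "(Inl w, Inr 0) \<in> parcs D" "(Inl w', Inr 0) \<in> parcs D"
    using w(1,2) prey adj by metis+
  with w(3,4) adj show False
    by blast
qed

text \<open>Injectivity keeps off-diagonal pairs off the diagonal, so a cover by cliques survives
  renaming. It is applied to \<open>Inl\<close> and to the labelling of \<open>G\<close> by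
  octahedron vertices.\<close>

lemma map_prod_image_Union_squares_diff_Id:
  assumes "inj_on g (\<Union>\<F>)"
  shows "map_prod g g ` ((\<Union>F \<in> \<F>. F \<times> F) - Id) = (\<Union>F \<in> \<F>. g ` F \<times> g ` F) - Id"
proof (intro subset_antisym subsetI)
  fix q
  assume "q \<in> map_prod g g ` ((\<Union>F \<in> \<F>. F \<times> F) - Id)"
  then obtain F x y where F: "F \<in> \<F>" "x \<in> F" "y \<in> F" "x \<noteq> y" "q = (g x, g y)"
    by auto
  then have "g x \<noteq> g y"
    using inj_onD[OF assms, of x y] by blast
  with F show "q \<in> (\<Union>F \<in> \<F>. g ` F \<times> g ` F) - Id"
    by blast
next
  fix q
  assume "q \<in> (\<Union>F \<in> \<F>. g ` F \<times> g ` F) - Id"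
  then obtain F x y where F: "F \<in> \<F>" "x \<in> F" "y \<in> F" "q = (g x, g y)" "g x \<noteq> g y"
    by blast
  then have "(x, y) \<in> (\<Union>F \<in> \<F>. F \<times> F) - Id"
    by auto
  then show "q \<in> map_prod g g ` ((\<Union>F \<in> \<F>. F \<times> F) - Id)"
    by (rule rev_image_eqI) (simp add: F(4))
qed

lemma competition_graph_add_isolated_2_of_faces:
  fixes a a' b b' c c' :: 'a
  assumes dist: "distinct [a, a', b, b', c, c']"
    and verts: "pverts G = {a, a', b, b', c, c'}"
    and arcs: "parcs G = (\<Union>F \<in> {{a, b, c}, {a, b', c'}, {a', b, c'}, {a', b', c}}. F \<times> F) - Id"
  obtains D where "pair_digraph D" "acyclic (parcs D)" "competition_graph D = add_isolated G 2"
proof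
  let ?D = "\<lparr> pverts = Inl ` pverts G \<union> Inr ` {..<2},
      parcs = Inl ` {a, b, c} \<times> {Inr 0} \<union> Inl ` {a, b', c'} \<times> {Inr 1} \<union>
        Inl ` {a', b, c'} \<times> {Inl a} \<union> Inl ` {a', b', c} \<times> {Inl b} \<rparr> :: ('a + nat) pair_pre_digraph"
  show D: "pair_digraph ?D"
    by unfold_locales (use dist in \<open>auto simp: verts\<close>)
  show "acyclic (parcs ?D)"
    \<comment> \<open>The rank drops along every arc: the predecessors \<open>a'\<close>,
      \<open>b\<close>, \<open>c'\<close> of \<open>a\<close> have rank at least 2, and the
      predecessors \<open>a'\<close>, \<open>b'\<close>, \<open>c\<close> of \<open>b\<close> have
      rank 3.\<close>
    by (rule acyclicI_order[where f = "\<lambda>v. if v \<in> range Inr then 0 else if v = Inl a then 1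
        else if v = Inl b then 2 else 3 :: nat"]) (use dist in auto)
  let ?N = "\<lambda>p. {x. (x, p) \<in> parcs ?D}"
  have "parcs (competition_graph ?D) = (\<Union>p \<in> {Inr 0, Inr 1, Inl a, Inl b}. ?N p \<times> ?N p) - Id"
    by (rule pair_wf_digraph.parcs_competition_graph)
      (use D in \<open>auto simp: pair_digraph_def pair_fin_digraph_def\<close>)
  also have "\<dots> = (\<Union>F \<in> {{a, b, c}, {a, b', c'}, {a', b, c'}, {a', b', c}}. Inl ` F \<times> Inl ` F) - Id"
  proof -
    have "?N (Inr 0) = Inl ` {a, b, c}" "?N (Inr 1) = Inl ` {a, b', c'}"
      "?N (Inl a) = Inl ` {a', b, c'}" "?N (Inl b) = Inl ` {a', b', c}"
      using dist by auto
    then show ?thesis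
      by (simp only: UN_insert UN_empty)
  qed
  also have "\<dots> = parcs (add_isolated G 2)"
    by (simp only: add_isolated_def pair_pre_digraph.simps arcs
        map_prod_image_Union_squares_diff_Id[OF inj_Inl])
  finally show "competition_graph ?D = add_isolated G 2"
    by (simp add: competition_graph_def add_isolated_def)
qed

text \<open>An isomorphism of the library carries a separate arc map. Here an arc is the pair of its
  ends, so the vertex map determines everything.\<close>

lemma digraph_iso_with_projE:
  assumes "digraph_iso (with_proj G) (with_proj H)"
  obtains f where "bij_betw f (pverts G) (pverts H)"
    "parcs G = {(x, y). x \<in> pverts G \<and> y \<in> pverts G \<and> (f x, f y) \<in> parcs H}"
proof -
  obtain h where h: "pre_digraph.digraph_isomorphism (with_proj G) h"
      "with_proj H = app_iso h (with_proj G)"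
    using assms by (auto simp: digraph_iso_def)
  \<comment> \<open>Well-formedness of \<open>G\<close> is part of the notion of
    isomorphism.\<close>
  then interpret wf_digraph "with_proj G"
    by (simp add: pre_digraph.digraph_isomorphism_def)
  let ?f = "iso_verts h"
  have inj: "inj_on ?f (pverts G)"
    using digraph_isomorphism_inj_on_verts[OF h(1)] by simp
  have "pverts H = ?f ` pverts G"
    using arg_cong[OF h(2), of verts] by simp
  with inj have bij: "bij_betw ?f (pverts G) (pverts H)"
    by (simp add: bij_betw_def)
  have arcs: "parcs H = (\<lambda>(u, v). (?f u, ?f v)) ` parcs G"
    using arcs_ends_app_iso_eq[OF h(1)] by (simp flip: h(2))
  have wf: "x \<in> pverts G \<and> y \<in> pverts G" if "(x, y) \<in> parcs G" for x y
    using that tail_in_verts head_in_verts by fastforce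
  have "(x, y) \<in> parcs G" if "x \<in> pverts G" "y \<in> pverts G" "(?f x, ?f y) \<in> parcs H" for x y
  proof -
    obtain u v where "(u, v) \<in> parcs G" "?f x = ?f u" "?f y = ?f v"
      using \<open>(?f x, ?f y) \<in> parcs H\<close> unfolding arcs by auto
    with that(1,2) wf show ?thesis
      using inj_onD[OF inj] by metis
  qed
  moreover have "(?f x, ?f y) \<in> parcs H" if "(x, y) \<in> parcs G" for x y
    using that unfolding arcs by (rule rev_image_eqI) simp
  ultimately have "parcs G = {(x, y). x \<in> pverts G \<and> y \<in> pverts G \<and> (?f x, ?f y) \<in> parcs H}"
    using wf by blast
  with bij that show thesis
    by blast
qed

text \<open>The four cliques come from the faces whose three signs have product 1. Two vertices that
  are neither equal nor antipodal fix two signs, and the third sign follows, so exactly one such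
  face contains both.\<close>

lemma octahedron_graph_iso_faces:
  fixes G :: "'a pair_pre_digraph"
  assumes "digraph_iso (with_proj G) (with_proj octahedron_graph)"
  obtains a a' b b' c c' where "distinct [a, a', b, b', c, c']" "pverts G = {a, a', b, b', c, c'}"
    "parcs G = (\<Union>F \<in> {{a, b, c}, {a, b', c'}, {a', b, c'}, {a', b', c}}. F \<times> F) - Id"
proof -
  obtain f where f: "bij_betw f (pverts G) (pverts octahedron_graph)"
    "parcs G = {(x, y). x \<in> pverts G \<and> y \<in> pverts G \<and> (f x, f y) \<in> parcs octahedron_graph}"
    using assms by (rule digraph_iso_with_projE)
  define e :: "3 \<Rightarrow> real^3" where "e i = axis i 1" for i
  have V: "pverts octahedron_graph = {e 1, - e 1, e 2, - e 2, e 3, - e 3}"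
    by (auto simp: octahedron_graph_pverts e_def UNIV_3)
  have e_eq: "e i = e j \<longleftrightarrow> i = j" and e_neq: "e i \<noteq> - e j" for i j
    by (auto simp: e_def axis_eq_axis vec_eq_iff axis_def split: if_splits)
  have e_neq': "- e j \<noteq> e i" for i j
    using e_neq[of i j] by metis
  note e_simps = e_eq e_neq e_neq'
  \<comment> \<open>The inverse of \<open>f\<close> carries the coordinate labels over to
    \<open>G\<close>.\<close>
  define g where "g = the_inv_into (pverts G) f"
  have g: "bij_betw g (pverts octahedron_graph) (pverts G)"
    unfolding g_def using f(1) by (rule bij_betw_the_inv_into)
  have fg: "f (g x) = x" if "x \<in> pverts octahedron_graph" for x
    unfolding g_def using f(1) that by (rule f_the_inv_into_f_bij_betw)
  have g_eq: "g x = g y \<longleftrightarrow> x = y" if "x \<in> pverts octahedron_graph" "y \<in> pverts octahedron_graph" for x y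
    using fg that by metis
  have vG: "pverts G = g ` pverts octahedron_graph"
    using g by (simp add: bij_betw_def)
  have arcs: "parcs G = map_prod g g ` parcs octahedron_graph"
    unfolding f(2) vG using fg by (auto simp: octahedron_graph_parcs image_iff)
  have arcs_O: "parcs octahedron_graph =
    (\<Union>F \<in> {{e 1, e 2, e 3}, {e 1, - e 2, - e 3}, {- e 1, e 2, - e 3}, {- e 1, - e 2, e 3}}. F \<times> F) - Id"
    (is "_ = ?E")
  proof (intro subset_antisym subrelI)
    fix x y
    assume "(x, y) \<in> parcs octahedron_graph"
    then have "x \<in> pverts octahedron_graph" "y \<in> pverts octahedron_graph" "x \<noteq> y" "x \<noteq> - y"
      by (auto simp: octahedron_graph_parcs)
    then show "(x, y) \<in> ?E"
      unfolding V by (elim insertE emptyE) (simp_all add: e_simps)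
  next
    fix x y
    assume "(x, y) \<in> ?E"
    then obtain F where F: "F \<in> {{e 1, e 2, e 3}, {e 1, - e 2, - e 3}, {- e 1, e 2, - e 3}, {- e 1, - e 2, e 3}}"
      "x \<in> F" "y \<in> F" "x \<noteq> y"
      by blast
    \<comment> \<open>No face contains an antipodal pair, so its distinct vertices are
      adjacent.\<close>
    from F(1) have "F \<subseteq> pverts octahedron_graph" "\<forall>x \<in> F. - x \<notin> F"
      unfolding V by (elim insertE emptyE; simp add: e_simps)+
    with F(2-4) show "(x, y) \<in> parcs octahedron_graph"
      unfolding octahedron_graph_parcs by auto
  qed
  show thesis
  proof (rule that)
    show "distinct [g (e 1), g (- e 1), g (e 2), g (- e 2), g (e 3), g (- e 3)]"
      by (simp add: g_eq V e_simps)
    show "pverts G = {g (e 1), g (- e 1), g (e 2), g (- e 2), g (e 3), g (- e 3)}"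
      by (simp add: vG V)
    have "inj_on g (pverts octahedron_graph)"
      using g by (simp add: bij_betw_def)
    then have "inj_on g (\<Union>{{e 1, e 2, e 3}, {e 1, - e 2, - e 3}, {- e 1, e 2, - e 3}, {- e 1, - e 2, e 3}})"
      by (rule inj_on_subset) (simp add: V)
    from map_prod_image_Union_squares_diff_Id[OF this]
    show "parcs G = (\<Union>F \<in> {{g (e 1), g (e 2), g (e 3)}, {g (e 1), g (- e 2), g (- e 3)},
        {g (- e 1), g (e 2), g (- e 3)}, {g (- e 1), g (- e 2), g (e 3)}}. F \<times> F) - Id"
      unfolding arcs arcs_O by (simp only: UN_insert UN_empty image_insert image_empty)
  qed
qed

theorem theorem2p3:
  fixes G :: "'a pair_pre_digraph"
  assumes "digraph_iso (with_proj G) (with_proj octahedron_graph)"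
  shows "competition_number G = 2"
proof -
  obtain a a' b b' c c' where G: "distinct [a, a', b, b', c, c']" "pverts G = {a, a', b, b', c, c'}"
    "parcs G = (\<Union>F \<in> {{a, b, c}, {a, b', c'}, {a', b, c'}, {a', b', c}}. F \<times> F) - Id"
    using assms by (rule octahedron_graph_iso_faces)
  have antipodal: "\<exists>w w'. (v, w) \<in> parcs G \<and> (v, w') \<in> parcs G \<and> w \<noteq> w' \<and> (w, w') \<notin> parcs G"
    if "v \<in> pverts G" for v
  \<comment> \<open>The nonadjacent neighbours of \<open>v\<close> are an antipodal pair that avoids
    \<open>v\<close>: \<open>b\<close>, \<open>b'\<close> if \<open>v\<close> is \<open>a\<close> or
    \<open>a'\<close>, and \<open>a\<close>, \<open>a'\<close> otherwise.\<close>
  proof (cases "v \<in> {a, a'}")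
    case True
    then show ?thesis
      by (intro exI[of _ b] exI[of _ b']) (use G(1) in \<open>auto simp: G(3)\<close>)
  next
    case False
    with that show ?thesis
      by (intro exI[of _ a] exI[of _ a']) (use G(1) in \<open>auto simp: G(2,3)\<close>)
  qed
  show ?thesis
    unfolding competition_number_def
  proof (rule Least_equality)
    show "\<exists>D. pair_digraph D \<and> acyclic (parcs D) \<and> competition_graph D = add_isolated G 2"
      using competition_graph_add_isolated_2_of_faces[OF G] by metis
  next
    fix k
    assume "\<exists>D. pair_digraph D \<and> acyclic (parcs D) \<and> competition_graph D = add_isolated G k"
    moreover have "pverts G \<noteq> {}"
      by (simp add: G(2))
    ultimately show "2 \<le> k"
      using competition_graph_add_isolated_ge_2 antipodal by metis
  qed
qed

end
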